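(* Let $0<\theta<1$, let $f:\Omega^2\to\mathbb{R}$ be Lipschitz with respect to $\hat d_\theta$, fix $z\in\Omega$, and let $$W(x,y)=\sum_{n\ge0}\Big(f(\hat\Phi^n(x,y))-f(\hat\Phi^n(x,z))\Big).$$ Then: 1. The skew map $\hat\Phi:\Omega^2\to\Omega^2$, $\hat\Phi(x,y)=(\sigma(x),\tau_{x_1}(y))$, is a homeomorphism. 2. The series defining $W(x,y)$ is absolutely convergent for all $x,y\in\Omega$. 3. There exists a Lipschitz function $g:\Omega^2\to\mathbb{R}$ (in the sense of item 4) such that $$f(x,y)=g(x,y)+W(x,y)-W(\hat\Phi(x,y))\quad\text{for all }x,y\in\Omega,$$ and $g(x,y)=g(x,y')$ for all $x,y,y'\in\Omega$. 4. $W$ is Lipschitz with respect to the metric $\hat d_{\sqrt\theta}$ on $\Omega^2$, with $\mathrm{Lip}(W)\le 2\,\mathrm{Lip}(f)\left(\frac{1+\theta}{1-\theta}\right)$. In particular, $g$ is also Lipschitz with respect to $\hat d_{\sqrt\theta}$.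
   Context: $\mathcal{A}=\{1,\dots,r\}$, $\Omega=\mathcal{A}^{\mathbb{N}}$, $\sigma$ the left shift on $\Omega$. For $0<\theta<1$, $d_\theta(x,x')=\theta^N$ where $N\ge1$ is the first index with $x_N\neq x'_N$ (and $0$ if $x=x'$), and $\hat d_\theta((x,y),(x',y'))=\max(d_\theta(x,x'),d_\theta(y,y'))$ on $\Omega^2=\Omega\times\Omega$. $\mathrm{Lip}(f)$ is the Lipschitz constant of $f$ with respect to $\hat d_\theta$ and $\mathrm{Lip}(W)$ that of $W$ with respect to $\hat d_{\sqrt\theta}$. Let $\phi:\mathcal{A}\times\mathcal{A}\to\mathcal{A}$ be such that $b\mapsto\phi(a,b)$ is bijective for every fixed $a$, and $\Phi(x_1,x_2,x_3,\dots)=(\phi(x_1,x_2),\phi(x_2,x_3),\dots)$. For $j\in\mathcal{A}$, $\tau_j(x)$ is the unique $y\in\Omega$ with $\Phi(y)=x$ and $y_1=j$. *)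

theory Defs
  imports "HOL-Analysis.Analysis"
begin

text \<open>
  The finite nonempty alphabet is a type \<open>'a :: finite\<close>.  Sequences are indexed from 0, so that
  the coordinate \<open>x\<^sub>N\<close> (with \<open>N \<ge> 1\<close>) of the mathematical text is \<open>x (N - 1)\<close> here.
\<close>

type_synonym 'a sequence = "nat \<Rightarrow> 'a"

definition shift :: "'a sequence \<Rightarrow> 'a sequence" where
  "shift x = (\<lambda>n. x (Suc n))"

text \<open>The \<open>Suc\<close> in the exponent compensates for indexing from 0.\<close>

definition seq_dist :: "real \<Rightarrow> 'a sequence \<Rightarrow> 'a sequence \<Rightarrow> real" where
  "seq_dist \<theta> x x' = (if x = x' then 0 else \<theta> ^ Suc (LEAST n. x n \<noteq> x' n))"

definition pair_dist ::
    "real \<Rightarrow> 'a sequence \<times> 'a sequence \<Rightarrow> 'a sequence \<times> 'a sequence \<Rightarrow> real" where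
  "pair_dist \<theta> p q = max (seq_dist \<theta> (fst p) (fst q)) (seq_dist \<theta> (snd p) (snd q))"

definition pair_metric :: "real \<Rightarrow> ('a sequence \<times> 'a sequence) metric" where
  "pair_metric \<theta> = metric (UNIV, pair_dist \<theta>)"

text \<open>The least Lipschitz constant; meaningful only for Lipschitz functions.\<close>

definition Lip :: "'b metric \<Rightarrow> ('b \<Rightarrow> real) \<Rightarrow> real" where
  "Lip m h = Inf {L. 0 \<le> L \<and> (\<forall>p\<in>mspace m. \<forall>q\<in>mspace m. \<bar>h p - h q\<bar> \<le> L * mdist m p q)}"

definition Phi :: "('a \<Rightarrow> 'a \<Rightarrow> 'a) \<Rightarrow> 'a sequence \<Rightarrow> 'a sequence" where
  "Phi \<phi> x = (\<lambda>n. \<phi> (x n) (x (Suc n)))"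

text \<open>Existence and uniqueness of \<open>y\<close> is lemma \<open>ex1_Phi_preimage\<close> below.\<close>

definition tau :: "('a \<Rightarrow> 'a \<Rightarrow> 'a) \<Rightarrow> 'a \<Rightarrow> 'a sequence \<Rightarrow> 'a sequence" where
  "tau \<phi> j x = (THE y. Phi \<phi> y = x \<and> y 0 = j)"

definition skew ::
    "('a \<Rightarrow> 'a \<Rightarrow> 'a) \<Rightarrow> 'a sequence \<times> 'a sequence \<Rightarrow> 'a sequence \<times> 'a sequence" where
  "skew \<phi> p = (shift (fst p), tau \<phi> (fst p 0) (snd p))"

definition W_term ::
    "('a \<Rightarrow> 'a \<Rightarrow> 'a) \<Rightarrow> ('a sequence \<times> 'a sequence \<Rightarrow> real) \<Rightarrow> 'a sequence
      \<Rightarrow> 'a sequence \<times> 'a sequence \<Rightarrow> nat \<Rightarrow> real" where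
  "W_term \<phi> f z p n = f ((skew \<phi> ^^ n) p) - f ((skew \<phi> ^^ n) (fst p, z))"

definition W ::
    "('a \<Rightarrow> 'a \<Rightarrow> 'a) \<Rightarrow> ('a sequence \<times> 'a sequence \<Rightarrow> real) \<Rightarrow> 'a sequence
      \<Rightarrow> 'a sequence \<times> 'a sequence \<Rightarrow> real" where
  "W \<phi> f z p = (\<Sum>n. W_term \<phi> f z p n)"


lemma ex1_Phi_preimage:
  assumes bij: "\<And>a. bij (\<phi> a)"
  shows "\<exists>!y. Phi \<phi> y = x \<and> y 0 = j"
proof (rule ex_ex1I)
  define y where "y = rec_nat j (\<lambda>n b. inv (\<phi> b) (x n))"
  have "y 0 = j" "\<And>n. y (Suc n) = inv (\<phi> (y n)) (x n)"
    by (simp_all add: y_def)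
  moreover have "\<phi> a (inv (\<phi> a) b) = b" for a b
    using bij[of a] by (simp add: bij_is_surj surj_f_inv_f)
  ultimately show "\<exists>y. Phi \<phi> y = x \<and> y 0 = j"
    by (intro exI[of _ y]) (simp add: Phi_def fun_eq_iff)
next
  fix y y' assume y: "Phi \<phi> y = x \<and> y 0 = j" and y': "Phi \<phi> y' = x \<and> y' 0 = j"
  have "y n = y' n" for n
  proof (induction n)
    case 0
    show ?case using y y' by simp
  next
    case (Suc n)
    have "\<phi> (y n) (y (Suc n)) = \<phi> (y' n) (y' (Suc n))"
      using y y' unfolding Phi_def by metis
    with Suc show ?case
      using bij[of "y n"] by (simp add: bij_is_inj inj_eq)
  qed
  then show "y = y'" by auto
qed

lemma Phi_tau:
  assumes "\<And>a. bij (\<phi> a)"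
  shows "Phi \<phi> (tau \<phi> j x) = x" "tau \<phi> j x 0 = j"
  using theI'[OF ex1_Phi_preimage[of \<phi> x j, OF assms]] by (simp_all add: tau_def)

lemma seq_dist_commute: "seq_dist \<theta> x y = seq_dist \<theta> y x"
  by (simp add: seq_dist_def eq_commute)

lemma seq_dist_nonneg: "0 < \<theta> \<Longrightarrow> 0 \<le> seq_dist \<theta> x y"
  by (simp add: seq_dist_def)

lemma seq_dist_zero: "0 < \<theta> \<Longrightarrow> seq_dist \<theta> x y = 0 \<longleftrightarrow> x = y"
  by (simp add: seq_dist_def)

lemma seq_dist_ultra:
  assumes "0 < \<theta>" "\<theta> < 1"
  shows "seq_dist \<theta> x z \<le> max (seq_dist \<theta> x y) (seq_dist \<theta> y z)"
proof (cases "x = y \<or> y = z \<or> x = z")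
  case True
  then show ?thesis
    using seq_dist_nonneg[OF assms(1), of y z] by (auto simp: seq_dist_def)
next
  case False
  let ?L = "\<lambda>u v. LEAST n. u n \<noteq> (v n :: 'a)"
  have "\<exists>n. x n \<noteq> z n" using False by auto
  then have "x (?L x z) \<noteq> z (?L x z)" by (rule LeastI_ex)
  then have "x (?L x z) \<noteq> y (?L x z) \<or> y (?L x z) \<noteq> z (?L x z)" by auto
  then have "?L x y \<le> ?L x z \<or> ?L y z \<le> ?L x z"
    by (auto intro: Least_le)
  then have "\<theta> ^ Suc (?L x z) \<le> \<theta> ^ Suc (?L x y) \<or> \<theta> ^ Suc (?L x z) \<le> \<theta> ^ Suc (?L y z)"
    using assms by (auto intro!: power_decreasing mult_left_mono)
  then show ?thesis using False by (auto simp: seq_dist_def le_max_iff_disj)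
qed

lemma Metric_space_pair_dist:
  assumes "0 < \<theta>" "\<theta> < 1"
  shows "Metric_space UNIV (pair_dist \<theta>)"
proof
  fix p q r :: "'a sequence \<times> 'a sequence"
  show "0 \<le> pair_dist \<theta> p q"
    by (simp add: pair_dist_def seq_dist_nonneg[OF assms(1)] le_max_iff_disj)
  show "pair_dist \<theta> p q = pair_dist \<theta> q p"
    by (simp add: pair_dist_def seq_dist_commute)
  show "pair_dist \<theta> p q = 0 \<longleftrightarrow> p = q"
    using seq_dist_nonneg[OF assms(1), of "fst p" "fst q"]
      seq_dist_nonneg[OF assms(1), of "snd p" "snd q"]
      seq_dist_zero[OF assms(1), of "fst p" "fst q"]
      seq_dist_zero[OF assms(1), of "snd p" "snd q"]
    unfolding pair_dist_def prod_eq_iff by linarith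
  show "pair_dist \<theta> p r \<le> pair_dist \<theta> p q + pair_dist \<theta> q r"
    using seq_dist_ultra[OF assms, of "fst p" "fst r" "fst q"]
      seq_dist_ultra[OF assms, of "snd p" "snd r" "snd q"]
      seq_dist_nonneg[OF assms(1), of "fst p" "fst q"]
      seq_dist_nonneg[OF assms(1), of "fst q" "fst r"]
      seq_dist_nonneg[OF assms(1), of "snd p" "snd q"]
      seq_dist_nonneg[OF assms(1), of "snd q" "snd r"]
    unfolding pair_dist_def by linarith
qed

lemma mspace_pair_metric: "0 < \<theta> \<Longrightarrow> \<theta> < 1 \<Longrightarrow> mspace (pair_metric \<theta>) = UNIV"
  and mdist_pair_metric: "0 < \<theta> \<Longrightarrow> \<theta> < 1 \<Longrightarrow> mdist (pair_metric \<theta>) = pair_dist \<theta>"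
  by (simp_all add: pair_metric_def Metric_space.mspace_metric Metric_space.mdist_metric
      Metric_space_pair_dist)

end

theory Submission
  imports Defs
begin

text \<open>
  The skew map is invertible with inverse \<open>(u, v) \<mapsto> (v\<^sub>1 u, \<Phi> v)\<close>, and both maps are Lipschitz.
  Each application of \<open>\<tau>\<close> gains one coordinate of agreement, so the \<open>n\<close>-th term of \<open>W\<close> is at
  most \<open>Lip(f) \<theta>\<^sup>n\<^sup>+\<^sup>1\<close>.  For two points that agree in their first \<open>k\<close> coordinates, the difference
  of the \<open>n\<close>-th terms is also at most \<open>2 Lip(f) \<theta>\<^sup>k\<^sup>-\<^sup>n\<^sup>+\<^sup>1\<close>.  Splitting the sum at \<open>n \<approx> k/2\<close>, using
  the second bound before and the first one after, gives the exponent \<open>k/2\<close>, that is, a Lipschitz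
  bound with respect to \<open>\<surd>\<theta>\<close>.  The function \<open>g = f - W + W \<circ> skew\<close> does not depend on
  \<open>y\<close>, because \<open>W(x, y) - W(x, y')\<close> is the sum of \<open>f\<close> over one orbit minus that over the other.
\<close>

section \<open>Common prefixes under the shift, \<open>Phi\<close>, \<open>tau\<close> and the skew
  map\<close>

definition agree :: "nat \<Rightarrow> 'a sequence \<Rightarrow> 'a sequence \<Rightarrow> bool" where
  "agree k x y \<longleftrightarrow> (\<forall>i<k. x i = y i)"

lemma agree_refl [simp]: "agree k x x"
  by (simp add: agree_def)

lemma agree_0 [simp]: "agree 0 x y"
  by (simp add: agree_def)

lemma agree_mono: "agree k x y \<Longrightarrow> l \<le> k \<Longrightarrow> agree l x y"
  by (simp add: agree_def)

lemma agree_shift: "agree (Suc k) x y \<Longrightarrow> agree k (shift x) (shift y)"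
  by (simp add: agree_def shift_def)

lemma agree_Phi: "agree (Suc k) x y \<Longrightarrow> agree k (Phi \<phi> x) (Phi \<phi> y)"
  by (simp add: agree_def Phi_def)

text \<open>Injectivity of \<open>\<phi> a\<close> makes each new coordinate of the preimage a
  function of the previous one and of one coordinate of the argument. The prescribed first symbol
  \<open>j\<close> is the coordinate gained.\<close>

lemma agree_tau:
  assumes "\<And>a. bij (\<phi> a)" and "agree k x y"
  shows "agree (Suc k) (tau \<phi> j x) (tau \<phi> j y)"
proof -
  have "i < Suc k \<Longrightarrow> tau \<phi> j x i = tau \<phi> j y i" for i
  proof (induction i)
    case 0
    show ?case by (simp add: Phi_tau[OF assms(1)])
  next
    case (Suc i)
    have "\<phi> (tau \<phi> j x i) (tau \<phi> j x (Suc i)) = x i"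
      and "\<phi> (tau \<phi> j y i) (tau \<phi> j y (Suc i)) = y i"
      using fun_cong[OF Phi_tau(1)[of \<phi> j x, OF assms(1)], of i]
        fun_cong[OF Phi_tau(1)[of \<phi> j y, OF assms(1)], of i]
      by (simp_all add: Phi_def)
    moreover have "x i = y i" "tau \<phi> j x i = tau \<phi> j y i"
      using Suc assms(2) by (simp_all add: agree_def)
    ultimately have "\<phi> (tau \<phi> j y i) (tau \<phi> j x (Suc i))
        = \<phi> (tau \<phi> j y i) (tau \<phi> j y (Suc i))"
      by simp
    then show ?case
      by (rule injD[OF bij_is_inj[OF assms(1)]])
  qed
  then show ?thesis by (simp add: agree_def)
qed

text \<open>The first \<open>n\<close> symbols of the first component choose the branches of
  \<open>tau\<close>, so both orbits use the same branches throughout. Each step then trades one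
  common coordinate of the first component for one of the second.\<close>

lemma agree_skew_funpow:
  assumes "\<And>a. bij (\<phi> a)"
  shows "agree (n + k) x x' \<Longrightarrow> agree l y y' \<Longrightarrow>
    agree k (fst ((skew \<phi> ^^ n) (x, y))) (fst ((skew \<phi> ^^ n) (x', y'))) \<and>
    agree (l + n) (snd ((skew \<phi> ^^ n) (x, y))) (snd ((skew \<phi> ^^ n) (x', y')))"
proof (induction n arbitrary: x x' y y' l)
  case 0
  then show ?case by simp
next
  case (Suc n)
  have "agree (n + k) (shift x) (shift x')"
    using Suc.prems(1) agree_shift by simp
  moreover have "agree (Suc l) (tau \<phi> (x 0) y) (tau \<phi> (x' 0) y')"
  proof -
    have "x 0 = x' 0" using Suc.prems(1) by (simp add: agree_def)
    then show ?thesis using agree_tau[where \<phi> = \<phi>, OF assms Suc.prems(2)] by simp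
  qed
  ultimately show ?case
    using Suc.IH[of "shift x" "shift x'" "Suc l" "tau \<phi> (x 0) y" "tau \<phi> (x' 0) y'"]
    by (simp add: funpow_Suc_right skew_def del: funpow.simps)
qed

section \<open>Common prefixes and the metric\<close>

lemma seq_dist_le_if_agree:
  assumes "0 < \<theta>" "\<theta> < 1" "agree k x y"
  shows "seq_dist \<theta> x y \<le> \<theta> ^ Suc k"
proof (cases "x = y")
  case False
  then have "\<exists>n. x n \<noteq> y n" by auto
  then have "x (LEAST n. x n \<noteq> y n) \<noteq> y (LEAST n. x n \<noteq> y n)"
    by (rule LeastI_ex)
  then have "k \<le> (LEAST n. x n \<noteq> y n)"
    using assms(3) unfolding agree_def by (meson not_less)
  with False show ?thesis
    using assms by (auto simp: seq_dist_def intro!: power_decreasing mult_left_mono)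
qed (use assms in \<open>simp add: seq_dist_def\<close>)

lemma pair_dist_le_if_agree:
  assumes "0 < \<theta>" "\<theta> < 1" "agree k (fst p) (fst q)" "agree k (snd p) (snd q)"
  shows "pair_dist \<theta> p q \<le> \<theta> ^ Suc k"
  unfolding pair_dist_def using assms by (intro max.boundedI seq_dist_le_if_agree)

lemma seq_dist_cases:
  assumes "x \<noteq> y"
  obtains k where "agree k x y" "seq_dist \<theta> x y = \<theta> ^ Suc k"
proof
  show "agree (LEAST n. x n \<noteq> y n) x y"
    unfolding agree_def using not_less_Least by blast
  show "seq_dist \<theta> x y = \<theta> ^ Suc (LEAST n. x n \<noteq> y n)"
    using assms by (simp add: seq_dist_def)
qed

text \<open>Together with \<open>seq_dist_le_if_agree\<close>, this identifies cylinders of length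
  \<open>k\<close> with closed balls of radius \<open>\<theta> ^ Suc k\<close>, so that metric
  estimates reduce to counting coordinates.\<close>

lemma agree_if_seq_dist_le:
  assumes "0 < \<theta>" "\<theta> < 1" "seq_dist \<theta> x y \<le> \<theta> ^ Suc k"
  shows "agree k x y"
proof (cases "x = y")
  case False
  then obtain l where l: "agree l x y" "seq_dist \<theta> x y = \<theta> ^ Suc l"
    by (rule seq_dist_cases)
  then have "Suc k \<le> Suc l"
    using assms power_decreasing_iff by metis
  then show ?thesis using l(1) agree_mono by simp
qed simp

text \<open>Each component distance is zero or a positive power of \<theta>, and distinct points
  exclude two zeros; hence the maximum is such a power.\<close>

lemma pair_dist_cases:
  assumes "0 < \<theta>" "\<theta> < 1" "p \<noteq> q"
  obtains k where "agree k (fst p) (fst q)" "agree k (snd p) (snd q)"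
    "pair_dist \<theta> p q = \<theta> ^ Suc k"
proof -
  have "\<exists>k. pair_dist \<theta> p q = \<theta> ^ Suc k"
  proof (cases "fst p = fst q \<or> snd p = snd q")
    case True
    then show ?thesis
      using assms seq_dist_cases[of "fst p" "fst q" \<theta>] seq_dist_cases[of "snd p" "snd q" \<theta>]
        seq_dist_nonneg[OF assms(1), of "fst p" "fst q"]
        seq_dist_nonneg[OF assms(1), of "snd p" "snd q"]
      unfolding pair_dist_def by (metis max.absorb1 max.absorb2 prod_eqI seq_dist_zero)
  next
    case False
    then show ?thesis
      using seq_dist_cases[of "fst p" "fst q" \<theta>] seq_dist_cases[of "snd p" "snd q" \<theta>]
      unfolding pair_dist_def by (metis max_def)
  qed
  then obtain k where k: "pair_dist \<theta> p q = \<theta> ^ Suc k" ..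
  \<comment> \<open>The maximum bounds both component distances, so the same \<open>k\<close> serves
    both components.\<close>
  then have "seq_dist \<theta> (fst p) (fst q) \<le> \<theta> ^ Suc k" "seq_dist \<theta> (snd p) (snd q) \<le> \<theta> ^ Suc k"
    by (simp_all add: pair_dist_def flip: k)
  with k that show ?thesis
    using agree_if_seq_dist_le[OF assms(1,2)] by blast
qed

lemma pair_dist_nonneg: "0 < \<theta> \<Longrightarrow> 0 \<le> pair_dist \<theta> p q"
  by (simp add: pair_dist_def seq_dist_nonneg le_max_iff_disj)

text \<open>Losing one coordinate of agreement costs at most a factor \<open>1 / \<theta>\<close>.\<close>

lemma pair_dist_map_le:
  assumes "0 < \<theta>" "\<theta> < 1"
    and h: "\<And>p q k. agree (Suc k) (fst p) (fst q) \<Longrightarrow> agree (Suc k) (snd p) (snd q) \<Longrightarrow>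
      agree k (fst (h p)) (fst (h q)) \<and> agree k (snd (h p)) (snd (h q))"
  shows "pair_dist \<theta> (h p) (h q) \<le> (1 / \<theta>) * pair_dist \<theta> p q"
proof (cases "p = q")
  case True
  then show ?thesis by (simp add: pair_dist_def seq_dist_def)
next
  case False
  then obtain k where k: "agree k (fst p) (fst q)" "agree k (snd p) (snd q)"
      "pair_dist \<theta> p q = \<theta> ^ Suc k"
    using pair_dist_cases[OF assms(1,2)] by metis
  have "pair_dist \<theta> (h p) (h q) \<le> \<theta> ^ k"
  proof (cases k)
    \<comment> \<open>Here the hypothesis on \<open>h\<close> gives nothing, but any two points are
      at distance at most \<theta>, which is below \<open>\<theta> ^ 0\<close>.\<close>
    case 0
    have "pair_dist \<theta> (h p) (h q) \<le> \<theta> ^ Suc 0"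
      by (rule pair_dist_le_if_agree) (use assms in simp_all)
    with 0 assms show ?thesis by simp
  next
    case (Suc l)
    then show ?thesis
      using h[of l p q] k pair_dist_le_if_agree[OF assms(1,2), of l "h p" "h q"] by simp
  qed
  also have "\<dots> = (1 / \<theta>) * pair_dist \<theta> p q"
    using assms(1) k(3) by simp
  finally show ?thesis .
qed

section \<open>The skew map as a homeomorphism\<close>

lemma agree_skew:
  assumes "\<And>a. bij (\<phi> a)"
    and "agree (Suc k) (fst p) (fst q)" "agree (Suc k) (snd p) (snd q)"
  shows "agree k (fst (skew \<phi> p)) (fst (skew \<phi> q)) \<and> agree k (snd (skew \<phi> p)) (snd (skew \<phi> q))"
proof -
  \<comment> \<open>Equal first symbols mean that the same branch of \<open>tau\<close> acts on both
    second components.\<close>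
  have "fst p 0 = fst q 0"
    using assms(2) by (simp add: agree_def)
  then show ?thesis
    using agree_shift[OF assms(2)] agree_tau[where \<phi> = \<phi> and j = "fst p 0", OF assms(1) assms(3)]
    by (simp add: skew_def agree_mono)
qed

text \<open>The symbol dropped by the shift survives as the first symbol of \<open>tau\<close>, from
  where it is put back in front.\<close>

definition skew_inv ::
    "('a \<Rightarrow> 'a \<Rightarrow> 'a) \<Rightarrow> 'a sequence \<times> 'a sequence \<Rightarrow> 'a sequence \<times> 'a sequence" where
  "skew_inv \<phi> p = (case_nat (snd p 0) (fst p), Phi \<phi> (snd p))"

lemma skew_inv_skew:
  assumes "\<And>a. bij (\<phi> a)"
  shows "skew_inv \<phi> (skew \<phi> p) = p"
proof -
  have "case_nat (fst p 0) (shift (fst p)) = fst p"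
    by (rule ext) (simp add: shift_def split: nat.split)
  then show ?thesis
    by (simp add: skew_inv_def skew_def Phi_tau[where \<phi> = \<phi>, OF assms])
qed

lemma skew_skew_inv:
  assumes "\<And>a. bij (\<phi> a)"
  shows "skew \<phi> (skew_inv \<phi> p) = p"
proof -
  \<comment> \<open>\<open>snd p\<close> is itself a preimage of \<open>Phi \<phi> (snd p)\<close>
    with the required first symbol, so uniqueness applies.\<close>
  have "tau \<phi> (snd p 0) (Phi \<phi> (snd p)) = snd p"
    unfolding tau_def by (rule the1_equality[OF ex1_Phi_preimage[where \<phi> = \<phi>, OF assms]]) simp
  then show ?thesis
    by (simp add: skew_inv_def skew_def shift_def)
qed

lemma agree_skew_inv:
  assumes "agree (Suc k) (fst p) (fst q)" "agree (Suc k) (snd p) (snd q)"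
  shows "agree k (fst (skew_inv \<phi> p)) (fst (skew_inv \<phi> q))
    \<and> agree k (snd (skew_inv \<phi> p)) (snd (skew_inv \<phi> q))"
  using assms agree_Phi[OF assms(2)]
  by (auto simp: skew_inv_def agree_def split: nat.split)

lemma continuous_map_pair_metric:
  assumes "0 < \<theta>" "\<theta> < 1"
    and "\<And>p q k. agree (Suc k) (fst p) (fst q) \<Longrightarrow> agree (Suc k) (snd p) (snd q) \<Longrightarrow>
      agree k (fst (h p)) (fst (h q)) \<and> agree k (snd (h p)) (snd (h q))"
  shows "continuous_map (mtopology_of (pair_metric \<theta>)) (mtopology_of (pair_metric \<theta>)) h"
proof -
  have "Lipschitz_continuous_map (pair_metric \<theta>) (pair_metric \<theta>) h"
    unfolding Lipschitz_continuous_map_def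
      mspace_pair_metric[OF assms(1,2)] mdist_pair_metric[OF assms(1,2)]
    using pair_dist_map_le[of \<theta> h, OF assms] by (intro conjI exI[of _ "1 / \<theta>"]) simp_all
  then show ?thesis by (rule Lipschitz_continuous_imp_continuous_map)
qed

lemma homeomorphic_map_skew:
  assumes "0 < \<theta>" "\<theta> < 1" "\<And>a. bij (\<phi> a)"
  shows "homeomorphic_map (mtopology_of (pair_metric \<theta>)) (mtopology_of (pair_metric \<theta>)) (skew \<phi>)"
proof -
  have "continuous_map (mtopology_of (pair_metric \<theta>)) (mtopology_of (pair_metric \<theta>)) (skew \<phi>)"
    by (rule continuous_map_pair_metric[OF assms(1,2)]) (rule agree_skew[OF assms(3)])
  moreover have
    "continuous_map (mtopology_of (pair_metric \<theta>)) (mtopology_of (pair_metric \<theta>)) (skew_inv \<phi>)"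
    by (rule continuous_map_pair_metric[OF assms(1,2)]) (rule agree_skew_inv)
  ultimately have "homeomorphic_maps (mtopology_of (pair_metric \<theta>)) (mtopology_of (pair_metric \<theta>))
      (skew \<phi>) (skew_inv \<phi>)"
    by (simp add: homeomorphic_maps_def skew_inv_skew[OF assms(3)] skew_skew_inv[OF assms(3)])
  then show ?thesis by (metis homeomorphic_map_maps)
qed

section \<open>Lipschitz functions and their least constants\<close>

lemma Lipschitz_continuous_map_pair_metric_iff:
  fixes f :: "'a sequence \<times> 'a sequence \<Rightarrow> real"
  assumes "0 < \<theta>" "\<theta> < 1"
  shows "Lipschitz_continuous_map (pair_metric \<theta>) euclidean_metric f \<longleftrightarrow>
    (\<exists>L\<ge>0. \<forall>p q. \<bar>f p - f q\<bar> \<le> L * pair_dist \<theta> p q)"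
proof
  assume "Lipschitz_continuous_map (pair_metric \<theta>) euclidean_metric f"
  then obtain B where "B > 0" "\<forall>p q. \<bar>f p - f q\<bar> \<le> B * pair_dist \<theta> p q"
    unfolding Lipschitz_continuous_map_pos
      mspace_pair_metric[OF assms(1,2)] mdist_pair_metric[OF assms(1,2)]
      mdist_euclidean_metric dist_real_def by blast
  then show "\<exists>L\<ge>0. \<forall>p q. \<bar>f p - f q\<bar> \<le> L * pair_dist \<theta> p q"
    by (intro exI[of _ B]) simp
next
  assume "\<exists>L\<ge>0. \<forall>p q. \<bar>f p - f q\<bar> \<le> L * pair_dist \<theta> p q"
  then show "Lipschitz_continuous_map (pair_metric \<theta>) euclidean_metric f"
    unfolding Lipschitz_continuous_map_def
      mspace_pair_metric[OF assms(1,2)] mdist_pair_metric[OF assms(1,2)]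
      mdist_euclidean_metric dist_real_def by auto
qed

lemma Lip_pair_metric:
  assumes "0 < \<theta>" "\<theta> < 1"
  shows "Lip (pair_metric \<theta>) f = Inf {L. 0 \<le> L \<and> (\<forall>p q. \<bar>f p - f q\<bar> \<le> L * pair_dist \<theta> p q)}"
  unfolding Lip_def mspace_pair_metric[OF assms] mdist_pair_metric[OF assms] by simp

text \<open>At positive distance every admissible constant dominates the difference quotient, hence
  so does the infimum. Thus the infimum is attained.\<close>

lemma Lip_nonneg_and_bound:
  assumes "0 < \<theta>" "\<theta> < 1" "Lipschitz_continuous_map (pair_metric \<theta>) euclidean_metric f"
  shows "0 \<le> Lip (pair_metric \<theta>) f" "\<bar>f p - f q\<bar> \<le> Lip (pair_metric \<theta>) f * pair_dist \<theta> p q"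
proof -
  let ?S = "{L. 0 \<le> L \<and> (\<forall>p q. \<bar>f p - f q\<bar> \<le> L * pair_dist \<theta> p q)}"
  have ne: "?S \<noteq> {}"
    using assms(3) unfolding Lipschitz_continuous_map_pair_metric_iff[OF assms(1,2)] by blast
  show "0 \<le> Lip (pair_metric \<theta>) f"
    unfolding Lip_pair_metric[OF assms(1,2)] by (rule cInf_greatest[OF ne]) simp
  show "\<bar>f p - f q\<bar> \<le> Lip (pair_metric \<theta>) f * pair_dist \<theta> p q"
  proof (cases "pair_dist \<theta> p q = 0")
    case True
    obtain K where "\<And>p q. \<bar>f p - f q\<bar> \<le> K * pair_dist \<theta> p q"
      using ne by blast
    from this[of p q] True show ?thesis by simp
  next
    case False
    then have pos: "pair_dist \<theta> p q > 0"
      using pair_dist_nonneg[OF assms(1), of p q] by simp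
    have "\<bar>f p - f q\<bar> / pair_dist \<theta> p q \<le> Inf ?S"
      by (rule cInf_greatest[OF ne]) (use pos in \<open>simp add: divide_le_eq del: split_paired_All\<close>)
    then show ?thesis
      using pos unfolding Lip_pair_metric[OF assms(1,2)] by (simp add: divide_le_eq)
  qed
qed

lemma Lip_le:
  assumes "0 < \<theta>" "\<theta> < 1" "0 \<le> L" "\<And>p q. \<bar>f p - f q\<bar> \<le> L * pair_dist \<theta> p q"
  shows "Lip (pair_metric \<theta>) f \<le> L"
  unfolding Lip_pair_metric[OF assms(1,2)]
  by (rule cInf_lower) (use assms in \<open>auto intro: bdd_belowI[of _ 0]\<close>)

section \<open>Convergence of the series and regularity of \<open>W\<close>\<close>

context
  fixes \<theta> L :: real
    and \<phi> :: "'a \<Rightarrow> 'a \<Rightarrow> 'a"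
    and f :: "'a sequence \<times> 'a sequence \<Rightarrow> real"
  assumes \<theta>: "0 < \<theta>" "\<theta> < 1"
    and bij: "\<And>a. bij (\<phi> a)"
    and L: "0 \<le> L" "\<And>p q. \<bar>f p - f q\<bar> \<le> L * pair_dist \<theta> p q"
begin

lemma abs_diff_le_if_agree:
  assumes "agree k (fst p) (fst q)" "agree k (snd p) (snd q)"
  shows "\<bar>f p - f q\<bar> \<le> L * \<theta> ^ Suc k"
  using L(2)[of p q] mult_left_mono[OF pair_dist_le_if_agree[OF \<theta> assms] L(1)] by linarith

lemma orbit_diff_le_if_agree:
  assumes "agree (n + k) x x'" "agree l y y'" "k \<le> l + n"
  shows "\<bar>f ((skew \<phi> ^^ n) (x, y)) - f ((skew \<phi> ^^ n) (x', y'))\<bar> \<le> L * \<theta> ^ Suc k"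
  using agree_skew_funpow[where \<phi> = \<phi>, OF bij assms(1,2)] assms(3)
  by (intro abs_diff_le_if_agree) (auto intro: agree_mono)

text \<open>Equal first components agree to every order, so only the \<open>n\<close> coordinates
  created by \<open>tau\<close> in the second component limit the estimate.\<close>

lemma orbit_diff_le:
  "\<bar>f ((skew \<phi> ^^ n) (x, y)) - f ((skew \<phi> ^^ n) (x, y'))\<bar> \<le> L * \<theta> ^ Suc n"
  by (rule orbit_diff_le_if_agree[of n n _ _ 0]) simp_all

lemma summable_geometric_bound: "summable (\<lambda>n. L * \<theta> ^ Suc n)"
  using \<theta> by (intro summable_mult) (simp add: summable_Suc_iff summable_geometric)

lemma summable_orbit_diff:
  "summable (\<lambda>n. f ((skew \<phi> ^^ n) (x, y)) - f ((skew \<phi> ^^ n) (x, y')))"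
  by (rule summable_comparison_test'[OF summable_geometric_bound, of 0]) (use orbit_diff_le in simp)

lemma abs_W_term_le: "\<bar>W_term \<phi> f z p n\<bar> \<le> L * \<theta> ^ Suc n"
  using orbit_diff_le[of n "fst p" "snd p" z] by (simp add: W_term_def)

lemma summable_abs_W_term: "summable (\<lambda>n. \<bar>W_term \<phi> f z p n\<bar>)"
  by (rule summable_comparison_test'[OF summable_geometric_bound, of 0]) (use abs_W_term_le in simp)

lemma summable_W_term: "summable (W_term \<phi> f z p)"
  using summable_abs_W_term by (rule summable_rabs_cancel)

text \<open>The reference orbit from \<open>(x, z)\<close> depends on \<open>x\<close> alone and
  cancels.\<close>

lemma W_diff_same_fst:
  "W \<phi> f z (x, y) - W \<phi> f z (x, y')
    = (\<Sum>n. f ((skew \<phi> ^^ n) (x, y)) - f ((skew \<phi> ^^ n) (x, y')))"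
  unfolding W_def
  by (simp add: suminf_diff[OF summable_W_term summable_W_term] W_term_def)

text \<open>Both images under \<open>skew\<close> have first component \<open>shift x\<close>, so
  their difference of \<open>W\<close> is again an orbit series: the original one without its term
  at index 0, which is \<open>f (x, y) - f (x, y')\<close>.\<close>

lemma W_coboundary_indep_snd:
  "f (x, y) - W \<phi> f z (x, y) + W \<phi> f z (skew \<phi> (x, y))
    = f (x, y') - W \<phi> f z (x, y') + W \<phi> f z (skew \<phi> (x, y'))"
proof -
  let ?d = "\<lambda>n. f ((skew \<phi> ^^ n) (x, y)) - f ((skew \<phi> ^^ n) (x, y'))"
  have "W \<phi> f z (skew \<phi> (x, y)) - W \<phi> f z (skew \<phi> (x, y')) = (\<Sum>n. ?d (Suc n))"
    unfolding skew_def fst_conv snd_conv W_diff_same_fst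
    by (simp add: funpow_Suc_right skew_def del: funpow.simps)
  also have "\<dots> = (\<Sum>n. ?d n) - ?d 0"
    by (rule suminf_split_head[OF summable_orbit_diff])
  finally show ?thesis
    using W_diff_same_fst[of z x y y'] by simp
qed

text \<open>Two pairs of orbits are compared, those from the points and the reference orbits from
  \<open>z\<close>; each contributes \<open>L\<close>. The first component is the bottleneck, with
  \<open>k - n\<close> common coordinates left.\<close>

lemma W_term_diff_le_if_agree:
  assumes "agree k (fst p) (fst q)" "agree k (snd p) (snd q)" "n \<le> k"
  shows "\<bar>W_term \<phi> f z p n - W_term \<phi> f z q n\<bar> \<le> 2 * L * \<theta> ^ (Suc k - n)"
proof -
  have "agree (n + (k - n)) (fst p) (fst q)"
    using assms by simp
  then have "\<bar>f ((skew \<phi> ^^ n) (fst p, y)) - f ((skew \<phi> ^^ n) (fst q, y'))\<bar> \<le> L * \<theta> ^ Suc (k - n)"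
    if "agree k y y'" for y y'
    by (rule orbit_diff_le_if_agree[OF _ that]) simp
  from this[OF assms(2)] this[of z z] show ?thesis
    using assms(3) by (simp add: W_term_def Suc_diff_le)
qed

lemma W_diff_le_if_agree:
  assumes "agree k (fst p) (fst q)" "agree k (snd p) (snd q)"
  shows "\<bar>W \<phi> f z p - W \<phi> f z q\<bar> \<le> 2 * L * ((1 + \<theta>) / (1 - \<theta>)) * sqrt \<theta> ^ Suc k"
proof -
  \<comment> \<open>The bounds with exponents \<open>Suc k - n\<close> and \<open>Suc n\<close>
    balance near \<open>k / 2\<close>, so the series is split there.\<close>
  define h where "h = Suc k div 2"
  define b where "b n = (if n \<le> h then \<theta> ^ (Suc k - n) else \<theta> ^ Suc n)" for n
  let ?d = "\<lambda>n. W_term \<phi> f z p n - W_term \<phi> f z q n"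
  have "h \<le> k" by (simp add: h_def)
  have d_le: "\<bar>?d n\<bar> \<le> 2 * L * b n" for n
  proof (cases "n \<le> h")
    case True
    then show ?thesis
      using W_term_diff_le_if_agree[OF assms] \<open>h \<le> k\<close> by (simp add: b_def)
  next
    case False
    then show ?thesis
      using abs_W_term_le[of z p n] abs_W_term_le[of z q n] by (simp add: b_def)
  qed
  \<comment> \<open>The tail starts at index \<open>h + 1\<close>, where the exponent
    \<open>Suc n\<close> equals \<open>h + 2\<close>.\<close>
  have tail: "(\<lambda>n. b (n + Suc h)) sums (\<theta> ^ (h + 2) / (1 - \<theta>))"
    using sums_mult[OF geometric_sums[of \<theta>], of "\<theta> ^ (h + 2)"] \<theta>
    by (simp add: b_def power_add mult_ac)
  have sum_b: "summable b"
    using sums_summable[OF tail] by (subst (asm) summable_iff_shift)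
  have "sum b {..<Suc h} = (\<Sum>n<Suc h. \<theta> ^ (Suc k - h) * \<theta> ^ (h - n))"
    using \<open>h \<le> k\<close> by (intro sum.cong) (auto simp: b_def simp flip: power_add)
  \<comment> \<open>Reversed, the head is a geometric sum starting from its largest term, the one at
    \<open>n = h\<close>.\<close>
  also have "\<dots> = \<theta> ^ (Suc k - h) * (\<Sum>n<Suc h. \<theta> ^ n)"
    by (simp only: sum_distrib_left[symmetric] sum.nat_diff_reindex[of "\<lambda>n. \<theta> ^ n" "Suc h", symmetric]
        diff_Suc_Suc)
  also have "\<dots> \<le> \<theta> ^ (Suc k - h) * (1 / (1 - \<theta>))"
    using \<theta> sum_le_suminf[OF summable_geometric[of \<theta>], of "{..<Suc h}"]
    by (intro mult_left_mono) (simp_all add: suminf_geometric)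
  finally have head: "sum b {..<Suc h} \<le> \<theta> ^ (Suc k - h) / (1 - \<theta>)"
    by simp
  \<comment> \<open>In powers of \<open>sqrt \<theta>\<close>, the exponents
    \<open>2 * (Suc k - h)\<close> and \<open>2 * (h + 1)\<close> are at least \<open>Suc k\<close>
    for either parity of \<open>k\<close>.\<close>
  have pow: "\<theta> ^ m = sqrt \<theta> ^ (2 * m)" for m
    using \<theta> by (simp add: power_mult)
  have sq: "0 \<le> sqrt \<theta>" "sqrt \<theta> \<le> 1"
    using \<theta> by auto
  have "\<theta> ^ (Suc k - h) \<le> sqrt \<theta> ^ Suc k"
    unfolding pow by (rule power_decreasing) (use sq in \<open>auto simp: h_def\<close>)
  \<comment> \<open>The tail keeps one spare factor \<theta>; the head contributes 1 and the tail
    \<theta> to the numerator \<open>1 + \<theta>\<close>.\<close>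
  moreover have "\<theta> ^ (h + 2) \<le> \<theta> * sqrt \<theta> ^ Suc k"
  proof -
    have "\<theta> ^ (h + 1) \<le> sqrt \<theta> ^ Suc k"
      unfolding pow by (rule power_decreasing) (use sq in \<open>auto simp: h_def\<close>)
    then show ?thesis using \<theta> by simp
  qed
  ultimately have num: "\<theta> ^ (h + 2) + \<theta> ^ (Suc k - h) \<le> (1 + \<theta>) * sqrt \<theta> ^ Suc k"
    by (simp add: distrib_right)
  have "suminf b \<le> \<theta> ^ (h + 2) / (1 - \<theta>) + \<theta> ^ (Suc k - h) / (1 - \<theta>)"
    using suminf_split_initial_segment[OF sum_b, of "Suc h"] sums_unique[OF tail] head by simp
  also have "\<dots> \<le> (1 + \<theta>) / (1 - \<theta>) * sqrt \<theta> ^ Suc k"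
    using divide_right_mono[OF num, of "1 - \<theta>"] \<theta>
    by (simp flip: add_divide_distrib)
  finally have b_le: "suminf b \<le> (1 + \<theta>) / (1 - \<theta>) * sqrt \<theta> ^ Suc k" .
  have "W \<phi> f z p - W \<phi> f z q = suminf ?d"
    unfolding W_def by (rule suminf_diff[OF summable_W_term summable_W_term])
  moreover have sum_2Lb: "summable (\<lambda>n. 2 * L * b n)"
    by (rule summable_mult[OF sum_b])
  moreover have sum_d: "summable (\<lambda>n. \<bar>?d n\<bar>)"
    by (rule summable_comparison_test'[OF sum_2Lb, of 0]) (use d_le in simp)
  ultimately have "\<bar>W \<phi> f z p - W \<phi> f z q\<bar> \<le> (\<Sum>n. 2 * L * b n)"
    using summable_rabs[OF sum_d] suminf_le[OF d_le sum_d sum_2Lb] by simp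
  also have "\<dots> = 2 * L * suminf b"
    by (rule suminf_mult[OF sum_b])
  also have "\<dots> \<le> 2 * L * ((1 + \<theta>) / (1 - \<theta>) * sqrt \<theta> ^ Suc k)"
    by (rule mult_left_mono[OF b_le]) (use L in simp)
  finally show ?thesis by (simp only: mult.assoc)
qed

lemma W_diff_le:
  "\<bar>W \<phi> f z p - W \<phi> f z q\<bar> \<le> 2 * L * ((1 + \<theta>) / (1 - \<theta>)) * pair_dist (sqrt \<theta>) p q"
proof (cases "p = q")
  case True
  then show ?thesis by (simp add: pair_dist_def seq_dist_def)
next
  case False
  then show ?thesis
    using pair_dist_cases[of "sqrt \<theta>" p q] W_diff_le_if_agree \<theta>
    by (metis real_sqrt_gt_0_iff real_sqrt_lt_1_iff)
qed

end

section \<open>Passage to the metric for \<open>sqrt \<theta>\<close> and the function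
  \<open>g\<close>\<close>

lemma pair_dist_mono:
  assumes "0 < \<theta>" "\<theta> \<le> \<theta>'"
  shows "pair_dist \<theta> p q \<le> pair_dist \<theta>' p q"
proof -
  have "seq_dist \<theta> x y \<le> seq_dist \<theta>' x y" for x y :: "'a sequence"
    unfolding seq_dist_def using power_mono[OF assms(2)] assms(1) by (auto simp del: power_Suc)
  then show ?thesis unfolding pair_dist_def by (meson max.mono)
qed

theorem theorem4p2:
  fixes \<theta> :: real
    and \<phi> :: "'a::finite \<Rightarrow> 'a \<Rightarrow> 'a"
    and f :: "'a sequence \<times> 'a sequence \<Rightarrow> real"
    and z :: "'a sequence"
  assumes "0 < \<theta>" and "\<theta> < 1"
    and "\<And>a. bij (\<phi> a)"
    and "Lipschitz_continuous_map (pair_metric \<theta>) euclidean_metric f"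
  shows "homeomorphic_map (mtopology_of (pair_metric \<theta>)) (mtopology_of (pair_metric \<theta>)) (skew \<phi>)
    \<and> (\<forall>x y. summable (\<lambda>n. \<bar>W_term \<phi> f z (x, y) n\<bar>))
    \<and> (\<exists>g. Lipschitz_continuous_map (pair_metric (sqrt \<theta>)) euclidean_metric g
          \<and> (\<forall>x y. f (x, y) = g (x, y) + W \<phi> f z (x, y) - W \<phi> f z (skew \<phi> (x, y)))
          \<and> (\<forall>x y y'. g (x, y) = g (x, y')))
    \<and> Lipschitz_continuous_map (pair_metric (sqrt \<theta>)) euclidean_metric (W \<phi> f z)
    \<and> Lip (pair_metric (sqrt \<theta>)) (W \<phi> f z)
        \<le> 2 * Lip (pair_metric \<theta>) f * ((1 + \<theta>) / (1 - \<theta>))"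
proof (intro conjI exI)
  \<comment> \<open>The least constant is itself admissible, so the estimates for \<open>W\<close>
    apply with it directly.\<close>
  define L where "L = Lip (pair_metric \<theta>) f"
  note L = Lip_nonneg_and_bound[OF assms(1,2,4), folded L_def]
  define C where "C = 2 * L * ((1 + \<theta>) / (1 - \<theta>))"
  have s: "0 < sqrt \<theta>" "sqrt \<theta> < 1"
    using assms by auto
  have C: "0 \<le> C"
    unfolding C_def using L(1) assms by simp
  note W_le = W_diff_le[where \<phi> = \<phi>, OF assms(1-3) L, of z, folded C_def]
  \<comment> \<open>The required identity, solved for \<open>g\<close>.\<close>
  let ?g = "\<lambda>p. f p - W \<phi> f z p + W \<phi> f z (skew \<phi> p)"
  show "homeomorphic_map (mtopology_of (pair_metric \<theta>)) (mtopology_of (pair_metric \<theta>)) (skew \<phi>)"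
    by (rule homeomorphic_map_skew[OF assms(1-3)])
  show "\<forall>x y. summable (\<lambda>n. \<bar>W_term \<phi> f z (x, y) n\<bar>)"
    using summable_abs_W_term[where \<phi> = \<phi>, OF assms(1-3) L] by blast
  show "\<forall>x y. f (x, y) = ?g (x, y) + W \<phi> f z (x, y) - W \<phi> f z (skew \<phi> (x, y))"
    by simp
  show "\<forall>x y y'. ?g (x, y) = ?g (x, y')"
    using W_coboundary_indep_snd[where \<phi> = \<phi>, OF assms(1-3) L] by blast
  show "Lipschitz_continuous_map (pair_metric (sqrt \<theta>)) euclidean_metric (W \<phi> f z)"
    unfolding Lipschitz_continuous_map_pair_metric_iff[OF s] using C W_le by blast
  show "Lip (pair_metric (sqrt \<theta>)) (W \<phi> f z) \<le> 2 * Lip (pair_metric \<theta>) f * ((1 + \<theta>) / (1 - \<theta>))"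
    using Lip_le[OF s C W_le] by (simp only: C_def L_def)
  \<comment> \<open>The summands come from \<open>f\<close>, \<open>W\<close> and \<open>W\<close>
    after \<open>skew\<close>; the last carries the Lipschitz factor
    \<open>1 / sqrt \<theta>\<close> of \<open>skew\<close>.\<close>
  have "\<bar>?g p - ?g q\<bar> \<le> (L + C + C * (1 / sqrt \<theta>)) * pair_dist (sqrt \<theta>) p q" for p q
  proof -
    \<comment> \<open>The metric for \<open>sqrt \<theta>\<close> dominates the one for \<theta>, so
      \<open>f\<close> keeps its constant.\<close>
    have "\<theta> \<le> sqrt \<theta>"
      using assms by (intro real_le_rsqrt) (simp add: power2_eq_square)
    then have "\<bar>f p - f q\<bar> \<le> L * pair_dist (sqrt \<theta>) p q"
      using L(2)[of p q] mult_left_mono[OF pair_dist_mono[of \<theta> "sqrt \<theta>" p q] L(1)] assms(1)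
      by linarith
    moreover have "\<bar>W \<phi> f z (skew \<phi> p) - W \<phi> f z (skew \<phi> q)\<bar>
        \<le> C * ((1 / sqrt \<theta>) * pair_dist (sqrt \<theta>) p q)"
      using W_le[of "skew \<phi> p" "skew \<phi> q"]
        mult_left_mono[OF pair_dist_map_le[where h = "skew \<phi>" and p = p and q = q, OF s
            agree_skew[where \<phi> = \<phi>, OF assms(3)]] C]
      by linarith
    ultimately show ?thesis
      using W_le[of p q] by (simp add: distrib_right)
  qed
  moreover have "0 \<le> L + C + C * (1 / sqrt \<theta>)"
    using L(1) C s by simp
  ultimately show "Lipschitz_continuous_map (pair_metric (sqrt \<theta>)) euclidean_metric ?g"
    unfolding Lipschitz_continuous_map_pair_metric_iff[OF s] by blast
qed

end
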